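(* Let $p,q\in\mathbb{N}$ with $\gcd(p,q)=1$ and $2p\le q$. Then $$A(p/q)=S_1(p,q)=S_2(p,q).$$ Moreover, let $(b_1^*,\dots,b_{p-1}^* )$ be an optimal solution of linear programming problem 2, put $b_0^*=1$, $b_p^*=0$, and let $\varphi_{p,q}$ be the $1$-periodic piecewise linear function with vertices at the points $(\pm k/q,b_k^* )$, $k=0,1,\dots,p$, given on $[-1/2,1/2]$ by $$\varphi_{p,q}(x)=\begin{cases} b_k^*+(b_k^*-b_{k+1}^* )(k-q|x|), & k/q\le |x|<(k+1)/q,\quad k=0,1,\dots,p-1,\\ 0, & p/q\le |x|\le 1/2.\end{cases}$$ Then $\varphi_{p,q}$ is an extremal function for $A(p/q)$, i.e. $\varphi_{p,q}\in K(p/q)$ and its mean value $\int_{-1/2}^{1/2}\varphi_{p,q}(x)\,dx$ equals $A(p/q)$.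
   Context: For $0<h\le 1/2$, $K(h)$ denotes the class of continuous $1$-periodic even functions $f:\mathbb{R}\to\mathbb{R}$ such that: (1) $f(x)=\sum_{n=0}^{\infty}a_n\cos(2\pi nx)$; (2) $a_n\ge 0$ for all $n=0,1,2,\dots$; (3) $f(0)=\sum_{n=0}^{\infty}a_n=1$; (4) $f(x)=0$ for $h\le |x|\le 1/2$. Define $A(h)=\sup_{f\in K(h)}a_0=\sup_{f\in K(h)}\int_{-h}^{h}f(x)\,dx$. Linear programming problem 1: $S_1(p,q)$ is the maximum of $s_0$ over real $(s_0,\dots,s_{q-1})$ subject to $\sum_{r=0}^{q-1}s_r=1$; $\sum_{r=0}^{q-1}s_r\cos(2\pi rk/q)=0$ for $k=p,p+1,\dots,q-p$; and $s_r\ge 0$ for $r=0,1,\dots,q-1$. Linear programming problem 2: $S_2(p,q)$ is the maximum of $\frac1q\left(1+2\sum_{k=1}^{p-1}b_k\right)$ over real $(b_1,\dots,b_{p-1})$ subject to $1+2\sum_{k=1}^{p-1}b_k\cos(2\pi rk/q)\ge 0$ for $r=0,1,\dots,q-1$. (For $p=1$ there are no variables and the sums are empty.) *)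

theory Defs
  imports "HOL-Analysis.Analysis"
begin

definition cosine_expansion :: "(nat \<Rightarrow> real) \<Rightarrow> (real \<Rightarrow> real) \<Rightarrow> bool" where
  "cosine_expansion a f \<longleftrightarrow>
     (\<forall>x. (\<lambda>n. a n * cos (2 * pi * real n * x)) sums f x) \<and>
     (\<forall>n. a n \<ge> 0) \<and> f 0 = 1 \<and> a sums 1"

definition K :: "real \<Rightarrow> (real \<Rightarrow> real) set" where
  "K h = {f. continuous_on UNIV f \<and> (\<forall>x. f (x + 1) = f x) \<and> (\<forall>x. f (- x) = f x) \<and>
             (\<exists>a. cosine_expansion a f) \<and>
             (\<forall>x. h \<le> \<bar>x\<bar> \<and> \<bar>x\<bar> \<le> 1/2 \<longrightarrow> f x = 0)}"

definition A :: "real \<Rightarrow> real" where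
  "A h = Sup {a 0 |a f. f \<in> K h \<and> cosine_expansion a f}"

text \<open>The vectors of both linear programs are represented by functions on \<open>nat\<close>; only the values
  at the indices \<open>0, \<dots>, q - 1\<close> resp. \<open>1, \<dots>, p - 1\<close> are constrained or used.\<close>

definition lp1_feasible :: "nat \<Rightarrow> nat \<Rightarrow> (nat \<Rightarrow> real) \<Rightarrow> bool" where
  "lp1_feasible p q s \<longleftrightarrow>
     (\<Sum>r<q. s r) = 1 \<and>
     (\<forall>k\<in>{p..q - p}. (\<Sum>r<q. s r * cos (2 * pi * real r * real k / real q)) = 0) \<and>
     (\<forall>r<q. s r \<ge> 0)"

definition lp1_optimal :: "nat \<Rightarrow> nat \<Rightarrow> (nat \<Rightarrow> real) \<Rightarrow> bool" where
  "lp1_optimal p q s \<longleftrightarrow> lp1_feasible p q s \<and> (\<forall>t. lp1_feasible p q t \<longrightarrow> t 0 \<le> s 0)"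

definition lp2_feasible :: "nat \<Rightarrow> nat \<Rightarrow> (nat \<Rightarrow> real) \<Rightarrow> bool" where
  "lp2_feasible p q b \<longleftrightarrow>
     (\<forall>r<q. 1 + 2 * (\<Sum>k=1..<p. b k * cos (2 * pi * real r * real k / real q)) \<ge> 0)"

definition lp2_objective :: "nat \<Rightarrow> nat \<Rightarrow> (nat \<Rightarrow> real) \<Rightarrow> real" where
  "lp2_objective p q b = 1 / real q * (1 + 2 * (\<Sum>k=1..<p. b k))"

definition lp2_optimal :: "nat \<Rightarrow> nat \<Rightarrow> (nat \<Rightarrow> real) \<Rightarrow> bool" where
  "lp2_optimal p q b \<longleftrightarrow>
     lp2_feasible p q b \<and> (\<forall>c. lp2_feasible p q c \<longrightarrow> lp2_objective p q c \<le> lp2_objective p q b)"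

text \<open>\<open>S1\<close> and \<open>S2\<close> are meaningful only if the respective maximum is attained, i.e. if an optimal
  solution exists (see \<open>S1_eq\<close> and \<open>S2_eq\<close> below).\<close>

definition S1 :: "nat \<Rightarrow> nat \<Rightarrow> real" where
  "S1 p q = (GREATEST v. \<exists>s. lp1_feasible p q s \<and> v = s 0)"

definition S2 :: "nat \<Rightarrow> nat \<Rightarrow> real" where
  "S2 p q = (GREATEST v. \<exists>b. lp2_feasible p q b \<and> v = lp2_objective p q b)"

definition vertex :: "nat \<Rightarrow> (nat \<Rightarrow> real) \<Rightarrow> nat \<Rightarrow> real" where
  "vertex p b k = (if k = 0 then 1 else if k < p then b k else 0)"

text \<open>Here \<open>y\<close> is the distance from \<open>x\<close> to the nearest integer, which makes the function
  \<open>1\<close>-periodic and equals \<open>\<bar>x\<bar>\<close> on \<open>[-1/2, 1/2]\<close>; and \<open>k\<close> is the index with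
  \<open>k/q \<le> y < (k+1)/q\<close>. The lemmas \<open>phi_periodic\<close>, \<open>phi_piece\<close> and \<open>phi_zero\<close> give the
  piecewise description.\<close>

definition phi :: "nat \<Rightarrow> nat \<Rightarrow> (nat \<Rightarrow> real) \<Rightarrow> real \<Rightarrow> real" where
  "phi p q b x =
     (let y = \<bar>x - of_int (round x)\<bar>; k = nat \<lfloor>real q * y\<rfloor>
      in if y < real p / real q
         then vertex p b k + (vertex p b k - vertex p b (k + 1)) * (real k - real q * y)
         else 0)"

lemma S1_eq: "lp1_optimal p q s \<Longrightarrow> S1 p q = s 0"
  unfolding S1_def lp1_optimal_def by (rule Greatest_equality) auto

lemma S2_eq: "lp2_optimal p q b \<Longrightarrow> S2 p q = lp2_objective p q b"
  unfolding S2_def lp2_optimal_def by (rule Greatest_equality) auto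

lemma phi_periodic: "phi p q b (x + 1) = phi p q b x"
proof -
  have "round (x + 1) = round x + 1"
    unfolding round_def by linarith
  then show ?thesis by (simp add: phi_def)
qed

lemma dist_round: "\<bar>x - of_int (round x)\<bar> = \<bar>x\<bar>" if "\<bar>x\<bar> \<le> 1/2" for x :: real
proof (cases "x = 1/2")
  case True
  have "round (1/2 :: real) = 1" by (simp add: round_def)
  then show ?thesis unfolding True by simp
next
  case False
  then have "round x = 0" using that by (auto simp: round_def floor_eq_iff abs_le_iff)
  then show ?thesis by simp
qed

lemma phi_piece:
  assumes "0 < q" "k < p" "\<bar>x\<bar> \<le> 1/2" "real k / real q \<le> \<bar>x\<bar>" "\<bar>x\<bar> < real (k + 1) / real q"
  shows "phi p q b x =
           vertex p b k + (vertex p b k - vertex p b (k + 1)) * (real k - real q * \<bar>x\<bar>)"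
proof -
  have "nat \<lfloor>real q * \<bar>x\<bar>\<rfloor> = k"
  proof -
    have "real k \<le> real q * \<bar>x\<bar>" "real q * \<bar>x\<bar> < real k + 1"
      using assms(1,4,5) by (simp_all add: field_simps)
    then have "\<lfloor>real q * \<bar>x\<bar>\<rfloor> = int k" by (simp add: floor_eq_iff)
    then show ?thesis by simp
  qed
  moreover have "\<bar>x\<bar> < real p / real q"
  proof -
    have "real (k + 1) / real q \<le> real p / real q"
      using assms(2) by (intro divide_right_mono) auto
    then show ?thesis using assms(5) by linarith
  qed
  ultimately show ?thesis by (simp add: phi_def dist_round[OF assms(3)])
qed

lemma phi_zero:
  assumes "real p / real q \<le> \<bar>x\<bar>" "\<bar>x\<bar> \<le> 1/2"
  shows "phi p q b x = 0"
  using assms(1) by (simp add: phi_def dist_round[OF assms(2)])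

text \<open>The leading coefficient is the mean value, so \<open>A\<close> is also the supremum of the integrals.\<close>

lemma integral_cos_period:
  assumes "n > 0"
  shows "((\<lambda>x. cos (2 * pi * real n * x)) has_integral 0) {-1/2..1/2}"
proof -
  let ?F = "\<lambda>x. sin (2 * pi * real n * x) / (2 * pi * real n)"
  have "((\<lambda>x. cos (2 * pi * real n * x)) has_integral ?F (1/2) - ?F (-1/2)) {-1/2..1/2}"
  proof (rule fundamental_theorem_of_calculus)
    fix x :: real
    show "(?F has_vector_derivative cos (2 * pi * real n * x)) (at x within {-1/2..1/2})"
      unfolding has_real_derivative_iff_has_vector_derivative[symmetric]
      using assms by (auto intro!: derivative_eq_intros)
  qed simp
  moreover have "?F (1/2) - ?F (-1/2) = 0"
    using sin_npi[of n] by (simp add: mult.commute)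
  ultimately show ?thesis by metis
qed

lemma cosine_expansion_mean:
  assumes "cosine_expansion a f"
  shows "(f has_integral a 0) {-1/2..1/2}"
proof -
  let ?g = "\<lambda>N x. \<Sum>n<N. a n * cos (2 * pi * real n * x)"
  have lim: "f = (\<lambda>x. \<Sum>n. a n * cos (2 * pi * real n * x))"
    using assms by (auto simp: cosine_expansion_def sums_iff)
  have "uniform_limit (cbox (-1/2) (1/2)) ?g f sequentially"
    unfolding lim
    by (rule Weierstrass_m_test[where M = a])
       (use assms in \<open>auto simp: cosine_expansion_def abs_mult sums_iff intro!: mult_left_le\<close>)
  then obtain I J where I: "\<And>N. (?g N has_integral I N) (cbox (-1/2) (1/2))"
    and J: "(f has_integral J) (cbox (-1/2) (1/2))" and IJ: "I \<longlonglongrightarrow> J"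
    by (rule uniform_limit_integral_cbox) (auto intro!: continuous_intros)
  have "(?g N has_integral a 0) {-1/2..1/2}" if "N > 0" for N
  proof -
    have "(?g N has_integral (\<Sum>n<N. if n = 0 then a 0 else 0)) {-1/2..1/2}"
    proof (rule has_integral_sum)
      fix n
      show "((\<lambda>x. a n * cos (2 * pi * real n * x)) has_integral (if n = 0 then a 0 else 0))
              {-1/2..1/2}"
      proof (cases "n = 0")
        case True
        then show ?thesis using has_integral_const_real[of "a 0" "-1/2" "1/2"] by simp
      next
        case False
        then show ?thesis
          using has_integral_mult_right[OF integral_cos_period[of n], of "a n"] by simp
      qed
    qed simp
    then show ?thesis using that by simp
  qed
  then have "I N = a 0" if "N > 0" for N
    using has_integral_unique[OF I[of N]] that by simp
  then have "eventually (\<lambda>N. I N = a 0) sequentially"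
    by (intro eventually_mono[OF eventually_gt_at_top[of 0]]) auto
  then have "J = a 0"
    by (intro LIMSEQ_unique[OF IJ] tendsto_eventually)
  then show ?thesis using J by simp
qed

lemma coeff_zero_eq_integral:
  assumes "0 < h" "h \<le> 1/2" "f \<in> K h" "cosine_expansion a f"
  shows "a 0 = integral {-h..h} f"
proof -
  have "integral {-h..h} f = integral {-1/2..1/2} f"
  proof (rule integral_spike_set)
    have "{x \<in> {-h..h} - {-1/2..1/2}. f x \<noteq> 0} = {}"
      using assms(2) by auto
    then show "negligible {x \<in> {-h..h} - {-1/2..1/2}. f x \<noteq> 0}" by (metis negligible_empty)
    have "f x = 0" if "x \<in> {-1/2..1/2} - {-h..h}" for x
    proof -
      have "h \<le> \<bar>x\<bar> \<and> \<bar>x\<bar> \<le> 1/2" using that by (auto simp: abs_if)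
      then show ?thesis using assms(3) by (simp add: K_def)
    qed
    then have "{x \<in> {-1/2..1/2} - {-h..h}. f x \<noteq> 0} = {}" by blast
    then show "negligible {x \<in> {-1/2..1/2} - {-h..h}. f x \<noteq> 0}" by (metis negligible_empty)
  qed
  then show ?thesis
    using cosine_expansion_mean[OF assms(4)] by (simp add: integral_unique)
qed

lemma A_eq_Sup_integral:
  assumes "0 < h" "h \<le> 1/2"
  shows "A h = (SUP f\<in>K h. integral {-h..h} f)"
proof -
  have "{a 0 |a f. f \<in> K h \<and> cosine_expansion a f} = (\<lambda>f. integral {-h..h} f) ` K h"
  proof (intro set_eqI iffI)
    fix v assume "v \<in> {a 0 |a f. f \<in> K h \<and> cosine_expansion a f}"
    then show "v \<in> (\<lambda>f. integral {-h..h} f) ` K h"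
      using coeff_zero_eq_integral[OF assms] by blast
  next
    fix v assume "v \<in> (\<lambda>f. integral {-h..h} f) ` K h"
    then obtain f where f: "f \<in> K h" "v = integral {-h..h} f" by blast
    then obtain a where a: "cosine_expansion a f" unfolding K_def by blast
    then have "v = a 0" using coeff_zero_eq_integral[OF assms f(1)] f(2) by simp
    then show "v \<in> {a 0 |a f. f \<in> K h \<and> cosine_expansion a f}" using f(1) a by blast
  qed
  then show ?thesis by (simp add: A_def)
qed

lemma bdd_above_coeff_zero: "bdd_above {a 0 |a f. f \<in> K h \<and> cosine_expansion a f}"
proof (rule bdd_aboveI)
  fix v assume "v \<in> {a 0 |a f. f \<in> K h \<and> cosine_expansion a f}"
  then obtain a f where "v = a 0" "cosine_expansion a f" by auto
  then show "v \<le> 1"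
    using sum_le_suminf[of a "{0}"] by (auto simp: cosine_expansion_def sums_iff)
qed

end

theory Submission
  imports Defs
begin

text \<open>The three values are compared in a closed cycle: a member of the class yields a feasible point of the
first program, that one of the second, and that again a member of the class, and in none of these
steps does the quantity to be maximised decrease.

From \<open>K\<close> to the first program: fold the coefficients of \<open>f \<in> K (p/q)\<close> along the residue
classes modulo \<open>q\<close>, \<open>s r = a r + a (q + r) + a (2 * q + r) + \<dots>\<close>. At a node \<open>k/q\<close> the cosines
depend on \<open>n\<close> only modulo \<open>q\<close>, so the equality constraints of the first program express that
\<open>f (k/q) = 0\<close> for \<open>p \<le> k \<le> q - p\<close>, and \<open>a 0 \<le> s 0\<close> because the folded terms are nonnegative
(lemma \<open>fold_coefficients_lp1_feasible\<close>).

From the first program to the second: the cosine transform \<open>b\<close> of a feasible \<open>s\<close> vanishes at the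
constrained frequencies, and finite Fourier inversion recovers the even part of \<open>s\<close> from the
remaining ones. Nonnegativity of \<open>s\<close> thus becomes feasibility of \<open>b\<close>, and the value at \<open>0\<close> gives
the objective (lemma \<open>lp1_to_lp2\<close>).

From the second program back to \<open>K\<close>: the piecewise linear function \<open>phi p q b\<close> is the
superposition of tents of half-width \<open>1/q\<close> centred at \<open>\<plusminus>k/q\<close>, with height \<open>1\<close> for \<open>k = 0\<close> and
\<open>b k\<close> for \<open>1 \<le> k < p\<close>. Hence its \<open>n\<close>-th cosine coefficient is that of a single tent, namely
\<open>1/q\<close> for \<open>n = 0\<close> and \<open>2 * q * (sin (pi * n / q))\<^sup>2 / (pi * n)\<^sup>2\<close> otherwise, times
\<open>1 + 2 * (\<Sum>k=1..<p. b k * cos (2 * pi * n * k / q))\<close>, which is nonnegative as \<open>b\<close> is feasible.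
So \<open>phi p q b \<in> K (p/q)\<close>, and its mean value is the objective of \<open>b\<close>
(lemmas \<open>phi_series\<close>, \<open>phi_coeff_nonneg\<close>, \<open>phi_coeff_0\<close>).

The pointwise expansion of a tent is the only analytic ingredient. Up to an
additive constant a tent is a second difference of the periodic continuation of a parabola, so it is enough to know that \<open>\<Sum>n. cos (n * t) / n\<^sup>2\<close> is a quadratic
polynomial on \<open>[0, 2 * pi]\<close> (lemma \<open>cos_series_over_squares\<close>).

The maximum in the first program exists by compactness; going round the cycle from a maximiser
turns all inequalities into equalities.\<close>

section \<open>The cosine series of a parabola\<close>

text \<open>Termwise differentiation of \<open>\<Sum>n. cos (n * t) / n\<^sup>2\<close> leads to a series that converges only
conditionally. With the damping factor \<open>r ^ n\<close> it is legitimate, and the derivative is the imaginary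
part of the Taylor series of \<open>Ln (1 - z)\<close> at \<open>z = r * cis t\<close>. In both series the term \<open>n = 0\<close> is
\<open>0\<close>, since division by \<open>0\<close> yields \<open>0\<close>.\<close>

lemma damped_cos_series_deriv:
  fixes r t :: real
  assumes "0 < r" "r < 1"
  shows "((\<lambda>t. \<Sum>n. r ^ n * cos (real n * t) / (real n)\<^sup>2) has_real_derivative
           Im (Ln (1 - of_real r * cis t))) (at t)"
proof -
  define f' where "f' n t = - (r ^ n * sin (real n * t) / real n)" for n t
  have "((\<lambda>t. \<Sum>n. r ^ n * cos (real n * t) / (real n)\<^sup>2) has_field_derivative (\<Sum>n. f' n t)) (at t)"
  proof (rule has_field_derivative_series'(2)[where S = UNIV and ?x0.0 = "pi / 2"])
    show "((\<lambda>t. r ^ n * cos (real n * t) / (real n)\<^sup>2) has_field_derivative f' n t) (at t within UNIV)"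
      for n t
      unfolding f'_def
      by (cases "n = 0") (auto intro!: derivative_eq_intros simp: field_simps power2_eq_square)
    have le: "\<bar>r ^ n * x / real n ^ k\<bar> \<le> r ^ n" if "\<bar>x\<bar> \<le> 1" for n k x
    proof (cases "n = 0 \<and> k \<noteq> 0")
      case False
      then have "1 \<le> real n ^ k" by (cases "k = 0") (auto intro: one_le_power)
      moreover have "r ^ n * \<bar>x\<bar> \<le> r ^ n * 1" using assms that by (intro mult_left_mono) auto
      ultimately show ?thesis using assms
        by (auto simp: abs_mult divide_simps intro: order_trans[OF _ mult_left_mono[of 1 "real n ^ k" "r ^ n"]])
    qed (use assms in \<open>auto simp: zero_power\<close>)
    show "uniformly_convergent_on UNIV (\<lambda>n x. \<Sum>i<n. f' i x)"
      using Weierstrass_m_test[of UNIV f' "\<lambda>n. r ^ n"] le[of "sin _" _ 1] assms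
      by (auto simp: uniformly_convergent_on_def f'_def)
    show "summable (\<lambda>n. r ^ n * cos (real n * (pi / 2)) / (real n)\<^sup>2)"
      by (rule summable_comparison_test[of _ "\<lambda>n. r ^ n"]) (use le[of "cos _" _ 2] assms in auto)
  qed auto
  moreover have "(\<lambda>n. f' n t) sums Im (Ln (1 - of_real r * cis t))"
  proof -
    let ?z = "of_real r * cis t"
    have "(\<lambda>n. - ((- (- ?z)) ^ n) / of_nat n) sums Ln (1 + - ?z)"
      by (rule Ln_series') (use assms in \<open>simp add: norm_mult\<close>)
    then have "(\<lambda>n. Im (- (?z ^ n) / of_nat n)) sums Im (Ln (1 - ?z))"
      using sums_Im by force
    moreover have "Im (- (?z ^ n) / of_nat n) = f' n t" for n
      by (simp add: f'_def power_mult_distrib Complex.DeMoivre flip: of_real_power)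
    ultimately show ?thesis by simp
  qed
  ultimately show ?thesis by (simp add: sums_iff)
qed

text \<open>The chord from \<open>cis t\<close> to \<open>1\<close> has the polar form
\<open>1 - cis t = 2 * sin (t / 2) * cis ((t - pi) / 2)\<close>.\<close>

lemma Ln_one_minus_cis:
  assumes "0 < t" "t < 2 * pi"
  shows "Im (Ln (1 - cis t)) = (t - pi) / 2"
proof -
  have s: "sin (t / 2) > 0" using assms by (intro sin_gt_zero) auto
  have "exp (Complex (ln (2 * sin (t / 2))) ((t - pi) / 2)) = 1 - cis t"
  proof (rule complex_eqI)
    have "cos t = 1 - 2 * (sin (t/2))\<^sup>2" using cos_double_sin[of "t/2"] by simp
    moreover have "cos ((t - pi) / 2) = sin (t / 2)"
      by (simp add: diff_divide_distrib cos_diff)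
    ultimately show "Re (exp (Complex (ln (2 * sin (t / 2))) ((t - pi) / 2))) = Re (1 - cis t)"
      using s by (simp add: Re_exp power2_eq_square)
    have "sin t = 2 * sin (t/2) * cos (t/2)" using sin_double[of "t/2"] by simp
    moreover have "sin ((t - pi) / 2) = - cos (t / 2)"
      by (simp add: diff_divide_distrib sin_diff)
    ultimately show "Im (exp (Complex (ln (2 * sin (t / 2))) ((t - pi) / 2))) = Im (1 - cis t)"
      using s by (simp add: Im_exp)
  qed
  then have "Ln (1 - cis t) = Complex (ln (2 * sin (t / 2))) ((t - pi) / 2)"
    by (rule Ln_unique) (use assms in auto)
  then show ?thesis by simp
qed

lemma summable_cos_over_square: "summable (\<lambda>n. cos (x n) / (real n)\<^sup>2)"
proof (rule summable_comparison_test)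
  show "summable (\<lambda>n. 1 / (real n)\<^sup>2)"
    using inverse_power_summable[of 2, where 'a = real] by (simp add: inverse_eq_divide)
  show "\<exists>N. \<forall>n\<ge>N. norm (cos (x n) / (real n)\<^sup>2) \<le> 1 / (real n)\<^sup>2"
    by (intro exI[of _ 0] allI impI) (simp add: abs_mult divide_right_mono)
qed

text \<open>Integrate the derivative of the damped series over \<open>[0, t]\<close> and let \<open>r\<close> tend to \<open>1\<close>: the integrands
are bounded by \<open>pi\<close> and converge to the linear function \<open>(x - pi) / 2\<close> away from \<open>x = 0\<close>. The
constant of integration is left as a series because it cancels in every second difference.\<close>

lemma cos_series_over_squares:
  assumes "0 \<le> t" "t \<le> 2 * pi"
  shows "(\<lambda>n. cos (real n * t) / (real n)\<^sup>2) sums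
           ((\<Sum>n. 1 / (real n)\<^sup>2) + (t\<^sup>2 - 2 * pi * t) / 4)"
proof -
  define G where "G r t = (\<Sum>n. r ^ n * cos (real n * t) / (real n)\<^sup>2)" for r t :: real
  define \<rho> where "\<rho> k = 1 - 1 / real (k + 2)" for k
  have \<rho>: "0 < \<rho> k" "\<rho> k < 1" for k by (auto simp: \<rho>_def)
  have \<rho>_lim: "\<rho> \<longlonglongrightarrow> 1"
    unfolding \<rho>_def
    using tendsto_diff[OF tendsto_const[of "1::real"] LIMSEQ_ignore_initial_segment[OF lim_1_over_n, of 2]]
    by simp
  have G_lim: "(\<lambda>k. G (\<rho> k) t) \<longlonglongrightarrow> G 1 t" for t
  proof -
    have "(\<lambda>k. \<Sum>n. \<rho> k ^ n * cos (real n * t) / (real n)\<^sup>2) \<longlonglongrightarrow>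
            (\<Sum>n. 1 ^ n * cos (real n * t) / (real n)\<^sup>2)"
    proof (rule tannerys_theorem[where M = "\<lambda>n. cos 0 / (real n)\<^sup>2", THEN conjunct2, THEN conjunct2])
      show "(\<lambda>k. \<rho> k ^ n * cos (real n * t) / (real n)\<^sup>2) \<longlonglongrightarrow> 1 ^ n * cos (real n * t) / (real n)\<^sup>2" for n
        unfolding divide_inverse by (intro tendsto_intros \<rho>_lim)
      have "\<bar>\<rho> k ^ n * cos (real n * t)\<bar> \<le> 1 * 1" for k n
        unfolding abs_mult by (intro mult_mono) (use \<rho>[of k] in \<open>auto intro!: power_le_one\<close>)
      then show "\<forall>\<^sub>F (n, k) in at_top \<times>\<^sub>F sequentially.
          norm (\<rho> k ^ n * cos (real n * t) / (real n)\<^sup>2) \<le> cos 0 / (real n)\<^sup>2"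
        by (intro always_eventually) (auto intro!: divide_right_mono)
    qed (use summable_cos_over_square[of "\<lambda>_. 0"] in auto)
    then show ?thesis by (simp add: G_def)
  qed
  have main: "G 1 t - G 1 0 = (t\<^sup>2 - 2 * pi * t) / 4" if t: "0 \<le> t" "t < 2 * pi" for t
  proof -
    \<comment> \<open>At \<open>x = 0\<close> the integrands are identically \<open>0\<close>, whereas \<open>(x - pi) / 2\<close> is not.\<close>
    define h where "h x = (if x = 0 then 0 else (x - pi) / 2)" for x :: real
    have "(h has_integral G 1 t - G 1 0) {0..t}"
    proof (rule has_integral_dominated_convergence)
      show "((\<lambda>x. Im (Ln (1 - of_real (\<rho> k) * cis x))) has_integral G (\<rho> k) t - G (\<rho> k) 0) {0..t}" for k
      proof (rule fundamental_theorem_of_calculus)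
        fix x
        show "(G (\<rho> k) has_vector_derivative Im (Ln (1 - of_real (\<rho> k) * cis x))) (at x within {0..t})"
          unfolding G_def using damped_cos_series_deriv[OF \<rho>[of k], of x]
          by (simp add: has_real_derivative_iff_has_vector_derivative has_vector_derivative_at_within)
      qed (use t in auto)
      have nz: "1 - of_real (\<rho> k) * cis x \<noteq> 0" for k x
      proof
        assume "1 - of_real (\<rho> k) * cis x = 0"
        then have "norm (of_real (\<rho> k) * cis x) = norm (1::complex)" by (simp add: eq_diff_eq)
        then show False using \<rho>[of k] by (simp add: norm_mult)
      qed
      show "\<forall>x\<in>{0..t}. norm (Im (Ln (1 - of_real (\<rho> k) * cis x))) \<le> pi" for k
      proof
        fix x
        show "norm (Im (Ln (1 - of_real (\<rho> k) * cis x))) \<le> pi"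
          using mpi_less_Im_Ln[OF nz[of k x]] Im_Ln_le_pi[OF nz[of k x]] by simp
      qed
      show "\<forall>x\<in>{0..t}. (\<lambda>k. Im (Ln (1 - of_real (\<rho> k) * cis x))) \<longlonglongrightarrow> h x"
      proof
        fix x assume x: "x \<in> {0..t}"
        show "(\<lambda>k. Im (Ln (1 - of_real (\<rho> k) * cis x))) \<longlonglongrightarrow> h x"
        proof (cases "x = 0")
          case True
          have "Im (Ln (of_real (1 - \<rho> k))) = 0" for k
            by (subst Ln_of_real) (use \<rho>[of k] in auto)
          then show ?thesis using True by (simp add: h_def)
        next
          case False
          have "cos x < 1"
          proof -
            have "cos x = 1 - 2 * (sin (x/2))\<^sup>2" using cos_double_sin[of "x/2"] by simp
            moreover have "sin (x/2) > 0" using x False t by (intro sin_gt_zero) auto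
            ultimately show ?thesis by simp
          qed
          then have "1 - of_real 1 * cis x \<notin> \<real>\<^sub>\<le>\<^sub>0"
            by (auto simp: complex_nonpos_Reals_iff)
          then have "(\<lambda>k. Im (Ln (1 - of_real (\<rho> k) * cis x))) \<longlonglongrightarrow> Im (Ln (1 - of_real 1 * cis x))"
            by (intro tendsto_intros \<rho>_lim)
          moreover have "Im (Ln (1 - of_real 1 * cis x)) = h x"
            using Ln_one_minus_cis[of x] x t False by (simp add: h_def)
          ultimately show ?thesis by simp
        qed
      qed
    qed (auto intro!: tendsto_intros G_lim)
    moreover have "(h has_integral (t\<^sup>2 - 2 * pi * t) / 4) {0..t}"
    proof (rule has_integral_spike_finite[of "{0}"])
      have "((\<lambda>x. (x - pi) / 2) has_integral (t\<^sup>2 - 2 * pi * t) / 4 - (0\<^sup>2 - 2 * pi * 0) / 4) {0..t}"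
        by (rule fundamental_theorem_of_calculus)
           (use t in \<open>auto intro!: derivative_eq_intros
              simp: has_real_derivative_iff_has_vector_derivative[symmetric]\<close>)
      then show "((\<lambda>x. (x - pi) / 2) has_integral (t\<^sup>2 - 2 * pi * t) / 4) {0..t}" by simp
    qed (auto simp: h_def)
    ultimately show ?thesis by (rule has_integral_unique)
  qed
  have "G 1 t - G 1 0 = (t\<^sup>2 - 2 * pi * t) / 4"
    \<comment> \<open>The integral misses the right end point, where the boundary function jumps; there the series
      has the same value as at \<open>0\<close>.\<close>
  proof (cases "t = 2 * pi")
    case True
    have "cos (real n * (2 * pi)) = 1" for n
      using cos_2npi[of n] by (simp add: mult_ac)
    then show ?thesis using True by (simp add: G_def power2_eq_square)
  qed (use main assms in auto)
  then have "G 1 t = G 1 0 + (t\<^sup>2 - 2 * pi * t) / 4" by linarith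
  then show ?thesis
    using summable_sums[OF summable_cos_over_square[of "\<lambda>n. real n * t"]] by (simp add: G_def)
qed

section \<open>Tents and their cosine coefficients\<close>

definition tent_coeff :: "nat \<Rightarrow> nat \<Rightarrow> real" where
  "tent_coeff q n =
     (if n = 0 then 1 / real q else 2 * real q * (sin (pi * real n / real q))\<^sup>2 / (pi * real n)\<^sup>2)"

lemma tent_coeff_nonneg: "tent_coeff q n \<ge> 0"
  by (simp add: tent_coeff_def)

text \<open>The tent of height \<open>1\<close> and half-width \<open>1/q\<close>. Since \<open>2 * (sin w)\<^sup>2 * cos u\<close> equals
\<open>cos u - (cos (u + 2 * w) + cos (u - 2 * w)) / 2\<close>, the terms with \<open>n > 0\<close> form a second difference with step
\<open>1/q\<close> of the series of a parabola. That difference is constant where all three points lie in one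
period and bends only when the left point \<open>y - 1/q\<close> crosses the corner of the parabola at \<open>0\<close>.
For \<open>\<bar>y\<bar> \<le> 1 - 1/q\<close> the right point does not pass the next corner at \<open>1\<close>; thus the formula
reaches beyond \<open>[-1/2, 1/2]\<close>, so that tents shifted by \<open>\<plusminus>k/q\<close> can be evaluated without
reduction modulo \<open>1\<close>.\<close>

lemma tent_series:
  fixes y :: real
  assumes "q \<ge> 2" "\<bar>y\<bar> \<le> 1 - 1 / real q"
  shows "(\<lambda>n. tent_coeff q n * cos (2 * pi * real n * y)) sums max 0 (1 - real q * \<bar>y\<bar>)"
proof -
  define z where "z = \<bar>y\<bar>"
  define c where "c = (\<Sum>n. 1 / (real n)\<^sup>2)"
  define \<delta> where "\<delta> = 1 / real q"
  have \<delta>: "0 < \<delta>" "\<delta> \<le> 1/2" using assms(1) by (auto simp: \<delta>_def field_simps)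
  have z: "0 \<le> z" "z + \<delta> \<le> 1" using assms(2) by (auto simp: z_def \<delta>_def)
  have C: "(\<lambda>n. cos (real n * (2 * pi * x)) / (real n)\<^sup>2) sums (c + pi\<^sup>2 * (x\<^sup>2 - x))"
    if "0 \<le> x" "x \<le> 1" for x
  proof -
    have "((2 * pi * x)\<^sup>2 - 2 * pi * (2 * pi * x)) / 4 = pi\<^sup>2 * (x\<^sup>2 - x)"
      by (simp add: power2_eq_square field_simps)
    then show ?thesis
      using cos_series_over_squares[of "2 * pi * x"] that by (simp add: c_def)
  qed
  \<comment> \<open>The left point of the difference may be negative; as cosine is even, it is replaced by its
    absolute value, where the formula for the parabola holds.\<close>
  define S where "S = (c + pi\<^sup>2 * (z\<^sup>2 - z)) - (c + pi\<^sup>2 * ((z + \<delta>)\<^sup>2 - (z + \<delta>))) / 2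
      - (c + pi\<^sup>2 * (\<bar>z - \<delta>\<bar>\<^sup>2 - \<bar>z - \<delta>\<bar>)) / 2"
  have "(\<lambda>n. cos (real n * (2 * pi * z)) / (real n)\<^sup>2 - cos (real n * (2 * pi * (z + \<delta>))) / (real n)\<^sup>2 / 2
      - cos (real n * (2 * pi * \<bar>z - \<delta>\<bar>)) / (real n)\<^sup>2 / 2) sums S"
    unfolding S_def by (intro sums_diff sums_divide C) (use z \<delta> in auto)
  then have "(\<lambda>n. real q / pi\<^sup>2 * (cos (real n * (2 * pi * z)) / (real n)\<^sup>2
        - cos (real n * (2 * pi * (z + \<delta>))) / (real n)\<^sup>2 / 2
        - cos (real n * (2 * pi * \<bar>z - \<delta>\<bar>)) / (real n)\<^sup>2 / 2) + (if n = 0 then 1 / real q else 0))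
      sums (real q / pi\<^sup>2 * S + 1 / real q)"
    by (intro sums_add sums_mult sums_single[of 0 "\<lambda>_. 1 / real q"])
  moreover have "real q / pi\<^sup>2 * (cos (real n * (2 * pi * z)) / (real n)\<^sup>2
        - cos (real n * (2 * pi * (z + \<delta>))) / (real n)\<^sup>2 / 2
        - cos (real n * (2 * pi * \<bar>z - \<delta>\<bar>)) / (real n)\<^sup>2 / 2) + (if n = 0 then 1 / real q else 0)
      = tent_coeff q n * cos (2 * pi * real n * y)" for n
  proof (cases "n = 0")
    case False
    define u where "u = real n * (2 * pi * z)"
    define w where "w = pi * real n / real q"
    have "cos (real n * (2 * pi * \<bar>z - \<delta>\<bar>)) = cos (u - 2 * w)"
    proof -
      have "u - 2 * w = (real n * (2 * pi)) * (z - \<delta>)"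
        by (simp add: u_def w_def \<delta>_def algebra_simps)
      then have "real n * (2 * pi * \<bar>z - \<delta>\<bar>) = \<bar>u - 2 * w\<bar>"
        by (simp add: abs_mult)
      then show ?thesis by simp
    qed
    moreover have "real n * (2 * pi * (z + \<delta>)) = u + 2 * w"
      by (simp add: u_def w_def \<delta>_def algebra_simps)
    moreover have "cos (2 * pi * real n * y) = cos u"
    proof -
      have "u = \<bar>2 * pi * real n * y\<bar>" by (simp add: u_def z_def abs_mult)
      then show ?thesis by simp
    qed
    moreover have "cos u - cos (u + 2 * w) / 2 - cos (u - 2 * w) / 2 = 2 * (sin w)\<^sup>2 * cos u"
    proof -
      have "cos (u + 2 * w) / 2 + cos (u - 2 * w) / 2 = cos u * cos (2 * w)"
        by (simp add: cos_add cos_diff field_simps)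
      then show ?thesis unfolding cos_double_sin[of w] by (simp add: algebra_simps)
    qed
    moreover have "cos u / (real n)\<^sup>2 - cos (u + 2 * w) / (real n)\<^sup>2 / 2 - cos (u - 2 * w) / (real n)\<^sup>2 / 2
        = (cos u - cos (u + 2 * w) / 2 - cos (u - 2 * w) / 2) / (real n)\<^sup>2"
      by (simp add: diff_divide_distrib)
    moreover have "real q / pi\<^sup>2 * (2 * (sin w)\<^sup>2 * cos u / (real n)\<^sup>2) =
        tent_coeff q n * cos u"
      using False by (simp add: tent_coeff_def w_def power_mult_distrib)
    ultimately show ?thesis using False by (simp only: u_def[symmetric]) simp
  qed (use assms in \<open>simp add: tent_coeff_def\<close>)
  moreover have "real q / pi\<^sup>2 * S + 1 / real q = max 0 (1 - real q * \<bar>y\<bar>)"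
  proof -
    have q\<delta>: "real q * \<delta> = 1" "1 / real q = \<delta>" using assms(1) by (auto simp: \<delta>_def)
    show ?thesis
    proof (cases "z < \<delta>")
      case True
      then have "S = pi\<^sup>2 * (\<delta> - z - \<delta>\<^sup>2)"
        by (simp add: S_def field_simps power2_eq_square)
      then have "real q / pi\<^sup>2 * S = real q * (\<delta> - z - \<delta>\<^sup>2)" by simp
      then have "real q / pi\<^sup>2 * S + 1 / real q = real q * \<delta> - real q * z - (real q * \<delta>) * \<delta> + \<delta>"
        by (simp only: q\<delta>(2)) (simp add: power2_eq_square algebra_simps)
      moreover have "real q * z \<le> real q * \<delta>" using True by (intro mult_left_mono) auto
      ultimately show ?thesis by (simp add: q\<delta>(1) flip: z_def)
    next
      case False
      then have "S = - (pi\<^sup>2 * \<delta>\<^sup>2)"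
        by (simp add: S_def field_simps power2_eq_square)
      then have "real q / pi\<^sup>2 * S + 1 / real q = \<delta> - (real q * \<delta>) * \<delta>"
        by (simp add: q\<delta>(2) power2_eq_square)
      moreover have "real q * \<delta> \<le> real q * z" using False by (intro mult_left_mono) auto
      ultimately show ?thesis by (simp add: q\<delta>(1) flip: z_def)
    qed
  qed
  ultimately show ?thesis by simp
qed

text \<open>At any point at most the two tents centred at the neighbouring integers are nonzero.\<close>

lemma sum_tents_eq_interpolation:
  fixes v :: "nat \<Rightarrow> real" and w :: real
  assumes "0 \<le> w" and v0: "\<And>k. k \<ge> p \<Longrightarrow> v k = 0"
  defines "k \<equiv> nat \<lfloor>w\<rfloor>"
  shows "(\<Sum>j<p. v j * max 0 (1 - \<bar>w - real j\<bar>)) = v k + (v k - v (k + 1)) * (real k - w)"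
proof -
  have k: "real k \<le> w" "w < real k + 1" using assms(1) unfolding k_def by linarith+
  let ?f = "\<lambda>j. v j * max 0 (1 - \<bar>w - real j\<bar>)"
  have "sum ?f {..<p} = sum ?f ({..<p} \<union> {k, k + 1})"
    by (rule sum.mono_neutral_left) (auto simp: v0)
  also have "\<dots> = sum ?f {k, k + 1}"
  proof (rule sum.mono_neutral_right)
    show "\<forall>j\<in>{..<p} \<union> {k, k + 1} - {k, k + 1}. ?f j = 0"
    proof
      fix j assume "j \<in> {..<p} \<union> {k, k + 1} - {k, k + 1}"
      then have "j + 1 \<le> k \<or> k + 2 \<le> j" by auto
      then have "real j + 1 \<le> real k \<or> real k + 2 \<le> real j" by linarith
      then show "?f j = 0" using k by auto
    qed
  qed auto
  also have "\<dots> = v k + (v k - v (k + 1)) * (real k - w)"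
    using k by (simp add: algebra_simps)
  finally show ?thesis .
qed

section \<open>The function phi as a superposition of tents\<close>

definition phi_coeff :: "nat \<Rightarrow> nat \<Rightarrow> (nat \<Rightarrow> real) \<Rightarrow> nat \<Rightarrow> real" where
  "phi_coeff p q b n =
     tent_coeff q n * (1 + 2 * (\<Sum>k=1..<p. b k * cos (2 * pi * real n * real k / real q)))"

lemma phi_coeff_0: "phi_coeff p q b 0 = lp2_objective p q b"
  by (simp add: phi_coeff_def lp2_objective_def tent_coeff_def)

lemma cos_mod_period:
  assumes "q > 0"
  shows "cos (2 * pi * real n * real k / real q) = cos (2 * pi * real (n mod q) * real k / real q)"
proof -
  have "real n = real q * real (n div q) + real (n mod q)"
    by (metis mult_div_mod_eq of_nat_add of_nat_mult)
  then have "2 * pi * real n * real k / real q =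
      2 * pi * real (n mod q) * real k / real q + 2 * pi * of_int (int (n div q * k))"
    using assms by (simp add: field_simps)
  then show ?thesis
    by (simp only: cos_add sin_int_2pin cos_int_2pin mult_1_right mult_zero_right diff_0_right)
qed

text \<open>Feasibility only controls the residues \<open>r < q\<close>, but the trigonometric polynomial takes at \<open>n\<close> the
same value as at \<open>n mod q\<close>.\<close>

lemma phi_coeff_nonneg:
  assumes "q > 0" "lp2_feasible p q b"
  shows "phi_coeff p q b n \<ge> 0"
proof -
  have "n mod q < q" using assms(1) by simp
  then have "0 \<le> 1 + 2 * (\<Sum>k=1..<p. b k * cos (2 * pi * real n * real k / real q))"
    using assms(2) unfolding lp2_feasible_def cos_mod_period[OF assms(1), of n] by blast
  then show ?thesis
    unfolding phi_coeff_def by (intro mult_nonneg_nonneg tent_coeff_nonneg)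
qed

text \<open>By evenness and periodicity it is enough to look at the distance \<open>y \<in> [0, 1/2]\<close> of \<open>x\<close> to the nearest
integer. There the tents centred at \<open>-k/q\<close> with \<open>1 \<le> k < p\<close> vanish, while those centred at \<open>k/q\<close>
interpolate the vertices of \<open>phi\<close>. Because \<open>k + 1 \<le> q / 2\<close>, all arguments \<open>y \<plusminus> k/q\<close> stay in
the range where the tent formula holds.\<close>

lemma phi_series:
  fixes x :: real
  assumes "p > 0" "q \<ge> 2" "2 * p \<le> q"
  shows "(\<lambda>n. phi_coeff p q b n * cos (2 * pi * real n * x)) sums phi p q b x"
proof -
  define y where "y = \<bar>x - of_int (round x)\<bar>"
  have y: "0 \<le> y" "y \<le> 1/2"
    using of_int_round_abs_le[of x] by (auto simp: y_def abs_minus_commute)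
  have cos_xy: "cos (2 * pi * real n * x) = cos (2 * pi * real n * y)" for n
  proof -
    have "cos (2 * pi * real n * y) = cos \<bar>2 * pi * real n * (x - of_int (round x))\<bar>"
      by (simp add: y_def abs_mult)
    also have "\<dots> = cos (2 * pi * real n * x - 2 * pi * of_int (int n * round x))"
      by (simp add: algebra_simps)
    also have "\<dots> = cos (2 * pi * real n * x)"
      by (simp only: cos_diff sin_int_2pin cos_int_2pin mult_1_right mult_zero_right add_0_right)
    finally show ?thesis by simp
  qed
  define T where "T z = max 0 (1 - real q * \<bar>z\<bar>)" for z :: real
  have T: "(\<lambda>n. tent_coeff q n * cos (2 * pi * real n * z)) sums T z" if "\<bar>z\<bar> \<le> 1 - 1 / real q" for z
    unfolding T_def using tent_series[OF assms(2) that] .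
  have inv_q: "1 / real q \<le> 1 / 2" using assms(2) by (simp add: field_simps)
  have kq: "real k / real q + 1 / real q \<le> 1 / 2" if "k < p" for k
  proof -
    have "2 * k + 2 \<le> q" using that assms(3) by linarith
    then have "2 * real k + 2 \<le> real q" by linarith
    then show ?thesis using assms(2) by (simp add: field_simps)
  qed
  have "(\<lambda>n. tent_coeff q n * cos (2 * pi * real n * y) + (\<Sum>k=1..<p. b k *
          (tent_coeff q n * cos (2 * pi * real n * (y - real k / real q)) +
           tent_coeff q n * cos (2 * pi * real n * (y + real k / real q)))))
        sums (T y + (\<Sum>k=1..<p. b k * (T (y - real k / real q) + T (y + real k / real q))))"
  proof (intro sums_add sums_sum sums_mult T)
    fix k assume "k \<in> {1..<p}"
    then have "real k / real q + 1 / real q \<le> 1 / 2" "0 \<le> real k / real q" using kq by auto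
    then show "\<bar>y - real k / real q\<bar> \<le> 1 - 1 / real q" "\<bar>y + real k / real q\<bar> \<le> 1 - 1 / real q"
      using y inv_q by linarith+
  qed (use y inv_q in linarith)
  moreover have "tent_coeff q n * cos (2 * pi * real n * y) + (\<Sum>k=1..<p. b k *
          (tent_coeff q n * cos (2 * pi * real n * (y - real k / real q)) +
           tent_coeff q n * cos (2 * pi * real n * (y + real k / real q))))
        = phi_coeff p q b n * cos (2 * pi * real n * x)" for n
  proof -
    have "cos (2 * pi * real n * (y - real k / real q)) + cos (2 * pi * real n * (y + real k / real q))
        = 2 * cos (2 * pi * real n * real k / real q) * cos (2 * pi * real n * y)" for k
      by (simp add: right_diff_distrib distrib_left cos_add cos_diff)
    then have "(\<Sum>k=1..<p. b k *
          (tent_coeff q n * cos (2 * pi * real n * (y - real k / real q)) +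
           tent_coeff q n * cos (2 * pi * real n * (y + real k / real q)))) =
        (\<Sum>k=1..<p. b k * (tent_coeff q n *
          (2 * cos (2 * pi * real n * real k / real q) * cos (2 * pi * real n * y))))"
      by (simp only: distrib_left[symmetric])
    then show ?thesis
      unfolding phi_coeff_def cos_xy
      by (simp add: distrib_left distrib_right sum_distrib_left sum_distrib_right mult_ac)
  qed
  moreover have "T y + (\<Sum>k=1..<p. b k * (T (y - real k / real q) + T (y + real k / real q))) = phi p q b x"
  proof -
    have T_right: "T (y + real k / real q) = 0" if "k \<in> {1..<p}" for k
    proof -
      have "1 \<le> real q * y + real k" using that y(1) by (simp add: add_increasing)
      then have "1 \<le> real q * \<bar>y + real k / real q\<bar>"
        using y(1) assms(2) by (simp add: distrib_left)
      then show ?thesis by (simp add: T_def)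
    qed
    have T_left: "T (y - real k / real q) = max 0 (1 - \<bar>real q * y - real k\<bar>)" for k
    proof -
      have "real q * \<bar>y - real k / real q\<bar> = \<bar>real q * (y - real k / real q)\<bar>"
        by (simp add: abs_mult)
      then show ?thesis using assms(2) by (simp add: T_def right_diff_distrib)
    qed
    have "(\<Sum>k=1..<p. b k * (T (y - real k / real q) + T (y + real k / real q))) =
          (\<Sum>k=1..<p. vertex p b k * max 0 (1 - \<bar>real q * y - real k\<bar>))"
      by (intro sum.cong refl) (use T_right T_left in \<open>simp add: vertex_def\<close>)
    moreover have "{..<p} = insert 0 {1..<p}" using assms(1) by auto
    ultimately have "T y + (\<Sum>k=1..<p. b k * (T (y - real k / real q) + T (y + real k / real q)))
        = (\<Sum>k<p. vertex p b k * max 0 (1 - \<bar>real q * y - real k\<bar>))"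
      using T_left[of 0] by (simp add: vertex_def)
    also have "\<dots> = (let k = nat \<lfloor>real q * y\<rfloor> in
        vertex p b k + (vertex p b k - vertex p b (k + 1)) * (real k - real q * y))"
      unfolding Let_def by (rule sum_tents_eq_interpolation) (use y assms(1) in \<open>auto simp: vertex_def\<close>)
    also have "\<dots> = phi p q b x"
    proof (cases "y < real p / real q")
      case True
      then show ?thesis by (simp add: phi_def y_def Let_def)
    next
      case False
      then have "real p \<le> real q * y" using assms(2) by (simp add: field_simps)
      then have "p \<le> nat \<lfloor>real q * y\<rfloor>" by (simp add: le_nat_floor)
      then have "vertex p b (nat \<lfloor>real q * y\<rfloor>) = 0" "vertex p b (nat \<lfloor>real q * y\<rfloor> + 1) = 0"
        using assms(1) by (auto simp: vertex_def)
      then show ?thesis using False by (simp add: phi_def y_def Let_def)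
    qed
    finally show ?thesis .
  qed
  ultimately show ?thesis by simp
qed

lemma phi_cosine_expansion:
  assumes "p > 0" "q \<ge> 2" "2 * p \<le> q" "lp2_feasible p q b"
  shows "cosine_expansion (phi_coeff p q b) (phi p q b)"
proof -
  have "phi p q b 0 = 1"
    using phi_piece[of q 0 p 0 b] assms by (simp add: vertex_def)
  then show ?thesis
    using phi_series[OF assms(1-3), of b] phi_series[OF assms(1-3), of b 0]
      phi_coeff_nonneg[OF _ assms(4)] assms(2)
    by (simp add: cosine_expansion_def)
qed

lemma cosine_expansion_continuous:
  assumes "cosine_expansion a f"
  shows "continuous_on UNIV f"
proof -
  have f: "f = (\<lambda>x. \<Sum>n. a n * cos (2 * pi * real n * x))"
    using assms by (auto simp: cosine_expansion_def sums_iff)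
  show ?thesis
  proof (rule uniform_limit_theorem)
    show "uniform_limit UNIV (\<lambda>N x. \<Sum>n<N. a n * cos (2 * pi * real n * x)) f sequentially"
      unfolding f by (rule Weierstrass_m_test[where M = a])
       (use assms in \<open>auto simp: cosine_expansion_def abs_mult sums_iff intro!: mult_left_le\<close>)
  qed (auto intro!: always_eventually continuous_intros)
qed

lemma cosine_expansion_even: "cosine_expansion a f \<Longrightarrow> f (- x) = f x"
  unfolding cosine_expansion_def by (metis (no_types, lifting) cos_minus mult_minus_right sums_unique2 sums_cong)

lemma phi_in_K:
  assumes "p > 0" "q \<ge> 2" "2 * p \<le> q" "lp2_feasible p q b"
  shows "phi p q b \<in> K (real p / real q)"
  using cosine_expansion_continuous cosine_expansion_even phi_cosine_expansion[OF assms]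
    phi_periodic phi_zero unfolding K_def by blast

section \<open>Folding coefficients modulo q\<close>

text \<open>Nodes in the right half of the period are reflected to the left half, where the support condition
applies directly.\<close>

lemma K_vanishes_at_nodes:
  assumes "p > 0" "2 * p \<le> q" "f \<in> K (real p / real q)" "k \<in> {p..q - p}"
  shows "f (real k / real q) = 0"
proof (cases "2 * k \<le> q")
  case True
  then have "real p / real q \<le> real k / real q" "real k / real q \<le> 1/2"
    using assms by (auto simp: field_simps)
  then show ?thesis using assms(3) by (simp add: K_def)
next
  case False
  have "k \<le> q" using assms by auto
  then have "- (real k / real q) + 1 = real (q - k) / real q"
    using assms by (simp add: field_simps of_nat_diff)
  moreover have "f (- (real k / real q) + 1) = f (real k / real q)"
    using assms(3) by (simp only: K_def mem_Collect_eq)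
  moreover have "real p / real q \<le> real (q - k) / real q" "real (q - k) / real q \<le> 1/2"
    using assms False by (auto simp: field_simps)
  then have "f (real (q - k) / real q) = 0"
    using assms(3) by (simp add: K_def)
  ultimately show ?thesis by simp
qed

text \<open>On the nodes \<open>k/q\<close> the frequencies \<open>n\<close> and \<open>n mod q\<close> are indistinguishable, so the cosine sum with
weights \<open>s\<close> reproduces \<open>f (k/q)\<close>.\<close>

lemma fold_coefficients_lp1_feasible:
  assumes "p > 0" "2 * p \<le> q" "f \<in> K (real p / real q)" "cosine_expansion a f"
  defines "s \<equiv> \<lambda>r. \<Sum>m. a (m * q + r)"
  shows "lp1_feasible p q s" "a 0 \<le> s 0"
proof -
  have q: "q > 0" using assms by auto
  have a: "\<And>n. a n \<ge> 0" "summable a" "a sums 1"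
    using assms(4) by (auto simp: cosine_expansion_def sums_iff)
  have smb: "summable (\<lambda>m. a (m * q + r))" for r
  proof -
    have "inj (\<lambda>m. m * q + r)" using q by (auto simp: inj_def)
    then show ?thesis using summable_reindex[of a "\<lambda>m. m * q + r"] a by (simp add: o_def)
  qed
  have nodes: "(\<Sum>r<q. s r * cos (2 * pi * real r * real k / real q)) = f (real k / real q)" for k
  proof (rule sums_unique2)
    have "(\<lambda>n. a n * cos (2 * pi * real n * (real k / real q))) sums f (real k / real q)"
      using assms(4) unfolding cosine_expansion_def by blast
    then have "(\<lambda>m. \<Sum>n\<in>{m * q..<m * q + q}. a n * cos (2 * pi * real n * (real k / real q)))
        sums f (real k / real q)"
      by (rule sums_group) (rule q)
    moreover have "(\<Sum>n\<in>{m * q..<m * q + q}. a n * cos (2 * pi * real n * (real k / real q))) =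
        (\<Sum>r<q. a (m * q + r) * cos (2 * pi * real r * real k / real q))" for m
    proof -
      have "(\<Sum>n\<in>{m * q..<m * q + q}. a n * cos (2 * pi * real n * real k / real q)) =
          (\<Sum>r<q. a (m * q + r) * cos (2 * pi * real (m * q + r) * real k / real q))"
        by (rule sum.reindex_bij_witness[of _ "\<lambda>r. m * q + r" "\<lambda>n. n - m * q"]) auto
      also have "\<dots> = (\<Sum>r<q. a (m * q + r) * cos (2 * pi * real r * real k / real q))"
        by (intro sum.cong refl) (subst cos_mod_period[OF q], simp)
      finally show ?thesis by simp
    qed
    ultimately show "(\<lambda>m. \<Sum>r<q. a (m * q + r) * cos (2 * pi * real r * real k / real q))
        sums f (real k / real q)" by simp
    show "(\<lambda>m. \<Sum>r<q. a (m * q + r) * cos (2 * pi * real r * real k / real q))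
        sums (\<Sum>r<q. s r * cos (2 * pi * real r * real k / real q))"
      unfolding s_def by (intro sums_sum sums_mult2 summable_sums smb)
  qed
  have "(\<Sum>r<q. s r) = 1"
    using nodes[of 0] assms(4) by (simp add: cosine_expansion_def)
  moreover have "s r \<ge> 0" for r
    unfolding s_def by (intro suminf_nonneg smb a)
  ultimately show "lp1_feasible p q s"
    using nodes K_vanishes_at_nodes[OF assms(1-3)] by (simp add: lp1_feasible_def)
  show "a 0 \<le> s 0"
    using sum_le_suminf[OF smb[of 0], of "{0}"] a(1) by (simp add: s_def)
qed

section \<open>Finite Fourier inversion\<close>

text \<open>A geometric sum of powers of a \<open>q\<close>-th root of unity, which is \<open>1\<close> exactly when \<open>q\<close> divides \<open>m\<close>.\<close>

lemma sum_cos_over_period: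
  fixes m :: int
  assumes "q > 0"
  shows "(\<Sum>k<q. cos (2 * pi * of_int m * real k / real q)) = (if int q dvd m then real q else 0)"
proof -
  define z where "z = cis (2 * pi * of_int m / real q)"
  have pow: "Re (z ^ k) = cos (2 * pi * of_int m * real k / real q)" for k
    by (simp add: z_def Complex.DeMoivre mult_ac)
  show ?thesis
  proof (cases "int q dvd m")
    case True
    then obtain j where "m = int q * j" by auto
    then have "cos (2 * pi * of_int m * real k / real q) = cos (2 * pi * of_int (j * int k))" for k
      using assms by (simp add: mult_ac)
    then show ?thesis using True by (simp only: cos_int_2pin) simp
  next
    case False
    have "z \<noteq> 1"
    proof
      assume "z = 1"
      then have "cos (2 * pi * of_int m / real q) = 1" using pow[of 1] by simp
      then obtain n :: int where "2 * pi * of_int m / real q = of_int n * 2 * pi"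
        by (auto simp: cos_one_2pi_int)
      then have "of_int m = real q * of_int n" using assms by (simp add: field_simps)
      then have "m = int q * n" by (metis of_int_eq_iff of_int_mult of_int_of_nat_eq)
      then show False using False by simp
    qed
    moreover have "z ^ q = 1"
      using assms cis_multiple_2pi[of "of_int m"] by (simp add: z_def Complex.DeMoivre)
    ultimately have "(\<Sum>k<q. z ^ k) = 0" by (simp add: sum_gp_strict)
    then have "Re (\<Sum>k<q. z ^ k) = 0" by simp
    then show ?thesis using False by (simp add: pow)
  qed
qed

lemma sum_symmetric_around_gap:
  fixes g :: "nat \<Rightarrow> real"
  assumes "p > 0" "2 * p \<le> q"
    and gap: "\<And>k. k \<in> {p..q - p} \<Longrightarrow> g k = 0"
    and sym: "\<And>k. k < p \<Longrightarrow> g (q - k) = g k"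
  shows "(\<Sum>k<q. g k) = g 0 + 2 * (\<Sum>k=1..<p. g k)"
proof -
  have "{..<q} = insert 0 ({1..<p} \<union> {p..q - p} \<union> {q - p<..<q})" using assms(1,2) by auto
  then have "(\<Sum>k<q. g k) = g 0 + sum g ({1..<p} \<union> {p..q - p} \<union> {q - p<..<q})"
    using assms(1) by simp
  also have "sum g ({1..<p} \<union> {p..q - p} \<union> {q - p<..<q}) =
      sum g {1..<p} + sum g {p..q - p} + sum g {q - p<..<q}"
  proof -
    have "sum g ({1..<p} \<union> {p..q - p}) = sum g {1..<p} + sum g {p..q - p}"
      by (rule sum.union_disjoint) auto
    moreover have "sum g ({1..<p} \<union> {p..q - p} \<union> {q - p<..<q}) =
        sum g ({1..<p} \<union> {p..q - p}) + sum g {q - p<..<q}"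
      by (rule sum.union_disjoint) (use assms(2) in auto)
    ultimately show ?thesis by simp
  qed
  also have "sum g {p..q - p} = 0" using gap by (intro sum.neutral) auto
  also have "sum g {q - p<..<q} = sum g {1..<p}"
  proof (rule sum.reindex_bij_witness[of _ "\<lambda>k. q - k" "\<lambda>k. q - k"])
    show "g (q - k) = g k" if "k \<in> {q - p<..<q}" for k
      using sym[of "q - k"] that by auto
  qed (use assms(2) in auto)
  finally show ?thesis by simp
qed

text \<open>Since \<open>b\<close> is symmetric under \<open>k \<mapsto> q - k\<close> and vanishes on \<open>{p..q - p}\<close>, the expression constrained
in the second program is the full inverse transform of \<open>b\<close>. By orthogonality it equals
\<open>q * (s t + s (q - t)) / 2\<close> for \<open>0 < t < q\<close>, which is nonnegative, and \<open>q * s 0\<close> for \<open>t = 0\<close>.\<close>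

lemma lp1_to_lp2:
  assumes "p > 0" "2 * p \<le> q" "lp1_feasible p q s"
  defines "b \<equiv> \<lambda>k. \<Sum>r<q. s r * cos (2 * pi * real r * real k / real q)"
  shows "lp2_feasible p q b" "lp2_objective p q b = s 0"
proof -
  have q: "q > 0" using assms by auto
  have s: "(\<Sum>r<q. s r) = 1" "\<And>k. k \<in> {p..q - p} \<Longrightarrow> b k = 0" "\<And>r. r < q \<Longrightarrow> s r \<ge> 0"
    using assms(3) by (auto simp: lp1_feasible_def b_def)
  define D where "D m = (\<Sum>k<q. cos (2 * pi * of_int m * real k / real q))" for m :: int
  have D: "D m = (if int q dvd m then real q else 0)" for m
    unfolding D_def by (rule sum_cos_over_period[OF q])
  have cos_reflect: "cos (2 * pi * real r * real (q - k) / real q) = cos (2 * pi * real r * real k / real q)"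
    if "k \<le> q" for r k
  proof -
    have "2 * pi * real r * real (q - k) / real q =
        2 * pi * of_int (int r) - 2 * pi * real r * real k / real q"
      using that q by (simp add: of_nat_diff field_simps)
    then show ?thesis by (simp only: cos_diff sin_int_2pin cos_int_2pin mult_1_left mult_zero_left add_0_right)
  qed
  have inversion: "1 + 2 * (\<Sum>k=1..<p. b k * cos (2 * pi * real t * real k / real q)) =
      (\<Sum>r<q. s r * (D (int r - int t) + D (int r + int t)) / 2)" for t
  proof -
    have "1 + 2 * (\<Sum>k=1..<p. b k * cos (2 * pi * real t * real k / real q)) =
        (\<Sum>k<q. b k * cos (2 * pi * real t * real k / real q))"
    proof (subst sum_symmetric_around_gap[OF assms(1,2)])
      show "b (q - k) * cos (2 * pi * real t * real (q - k) / real q) =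
          b k * cos (2 * pi * real t * real k / real q)" if "k < p" for k
        using cos_reflect[of k] that assms(2) by (simp add: b_def)
    qed (use s in \<open>auto simp: b_def\<close>)
    also have "\<dots> = (\<Sum>r<q. s r * (\<Sum>k<q. cos (2 * pi * real r * real k / real q)
        * cos (2 * pi * real t * real k / real q)))"
      unfolding b_def sum_distrib_right sum_distrib_left
      by (subst sum.swap) (simp add: mult_ac)
    also have "\<dots> = (\<Sum>r<q. s r * (D (int r - int t) + D (int r + int t)) / 2)"
    proof (intro sum.cong refl)
      fix r
      have "cos (2 * pi * real r * real k / real q) * cos (2 * pi * real t * real k / real q) =
         (cos (2 * pi * of_int (int r - int t) * real k / real q) +
          cos (2 * pi * of_int (int r + int t) * real k / real q)) / 2" for k
        by (simp add: cos_times_cos algebra_simps add_divide_distrib diff_divide_distrib)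
      then have "(\<Sum>k<q. cos (2 * pi * real r * real k / real q) * cos (2 * pi * real t * real k / real q))
          = (D (int r - int t) + D (int r + int t)) / 2"
        unfolding D_def by (simp only: sum.distrib sum_divide_distrib[symmetric])
      then show "s r * (\<Sum>k<q. cos (2 * pi * real r * real k / real q)
        * cos (2 * pi * real t * real k / real q)) = s r * (D (int r - int t) + D (int r + int t)) / 2"
        by simp
    qed
    finally show ?thesis .
  qed
  have "(\<Sum>r<q. s r * (D (int r - int t) + D (int r + int t)) / 2) \<ge> 0" for t
    by (intro sum_nonneg divide_nonneg_pos mult_nonneg_nonneg) (use s(3) in \<open>auto simp: D\<close>)
  then show "lp2_feasible p q b" unfolding lp2_feasible_def inversion by blast
  have "(\<Sum>r<q. s r * (D (int r) + D (int r)) / 2) = (\<Sum>r<q. if r = 0 then real q * s 0 else 0)"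
  proof (intro sum.cong refl)
    fix r assume "r \<in> {..<q}"
    then have "int q dvd int r \<longleftrightarrow> r = 0" by (auto dest: dvd_imp_le)
    then show "s r * (D (int r) + D (int r)) / 2 = (if r = 0 then real q * s 0 else 0)"
      by (simp add: D)
  qed
  then show "lp2_objective p q b = s 0"
    using inversion[of 0] q by (simp add: lp2_objective_def)
qed

section \<open>Existence of an optimal solution\<close>

text \<open>A feasible vector has entries in \<open>[0, 1]\<close>, being nonnegative with sum \<open>1\<close>. After setting the
unconstrained entries from index \<open>q\<close> on to \<open>0\<close>, the feasible set is a closed subset of a cube that is
compact in the product topology.\<close>

lemma lp1_optimal_exists:
  assumes "q > 0" "lp1_feasible p q s\<^sub>0"
  shows "\<exists>s. lp1_optimal p q s"
proof -
  define C where "C = {s :: nat \<Rightarrow> real. (\<forall>r. s r \<in> {0..1}) \<and> lp1_feasible p q s}"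
  define restr where "restr s r = (if r < q then s r else 0)" for s :: "nat \<Rightarrow> real" and r
  have restr: "restr s \<in> C" "restr s 0 = s 0" if s: "lp1_feasible p q s" for s
  proof -
    have nonneg: "0 \<le> s r" if "r < q" for r using s that by (simp add: lp1_feasible_def)
    have "s r \<le> 1" if "r < q" for r
    proof -
      have "s r \<le> (\<Sum>r<q. s r)" using that nonneg by (intro member_le_sum) auto
      then show ?thesis using s by (simp add: lp1_feasible_def)
    qed
    then have "restr s r \<in> {0..1}" for r using nonneg by (simp add: restr_def)
    moreover have "(\<Sum>r<q. restr s r * c r) = (\<Sum>r<q. s r * c r)" for c
      by (intro sum.cong) (auto simp: restr_def)
    from this[of "\<lambda>_. 1"] this have "lp1_feasible p q (restr s)"
      using s by (simp add: lp1_feasible_def restr_def)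
    ultimately show "restr s \<in> C" by (simp add: C_def)
  qed (use assms in \<open>simp add: restr_def\<close>)
  have "compact (PiE UNIV (\<lambda>_. {0..1}) :: (nat \<Rightarrow> real) set)"
    using compactin_PiE[of "\<lambda>_. euclidean" UNIV "\<lambda>_::nat. {0..1::real}"]
    by (simp add: euclidean_product_topology)
  moreover have "closed {s. lp1_feasible p q s}"
  proof -
    have lin: "continuous_on UNIV (\<lambda>s :: nat \<Rightarrow> real. \<Sum>r<q. s r * c r)" for c
      by (intro continuous_on_sum continuous_on_mult continuous_on_const
          continuous_on_product_coordinates)
    have "{s. lp1_feasible p q s} = {s. (\<Sum>r<q. s r * 1) = 1} \<inter>
        (\<Inter>k\<in>{p..q - p}. {s. (\<Sum>r<q. s r * cos (2 * pi * real r * real k / real q)) = 0}) \<inter>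
        (\<Inter>r\<in>{..<q}. {s. 0 \<le> s r})"
      by (auto simp: lp1_feasible_def)
    also have "closed \<dots>"
      by (intro closed_Int closed_INT ballI closed_Collect_eq closed_Collect_le lin
          continuous_on_const continuous_on_product_coordinates)
    finally show ?thesis .
  qed
  ultimately have "compact (PiE UNIV (\<lambda>_. {0..1}) \<inter> {s. lp1_feasible p q s})"
    by (rule compact_Int_closed)
  moreover have "C = PiE UNIV (\<lambda>_. {0..1}) \<inter> {s. lp1_feasible p q s}"
    by (auto simp: C_def PiE_iff)
  ultimately have "compact C" by simp
  moreover have "C \<noteq> {}" using restr[OF assms(2)] by auto
  moreover have "continuous_on C (\<lambda>s. s 0)"
    by (rule continuous_on_subset[OF continuous_on_product_coordinates subset_UNIV])
  ultimately obtain s where s: "s \<in> C" "\<And>t. t \<in> C \<Longrightarrow> t 0 \<le> s 0"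
    using continuous_attains_sup[of C "\<lambda>s. s 0"] by blast
  have "lp1_optimal p q s"
    unfolding lp1_optimal_def
  proof (intro conjI allI impI)
    show "lp1_feasible p q s" using s(1) by (simp add: C_def)
    show "t 0 \<le> s 0" if "lp1_feasible p q t" for t
      using s(2)[OF restr(1)[OF that]] restr(2)[OF that] by simp
  qed
  then show ?thesis by blast
qed

section \<open>The extremal problem\<close>

text \<open>The zero vector is feasible for the second program, and its tent function, folded, provides a feasible
point of the first; so a maximiser \<open>s\<close> exists. Its transform \<open>b\<^sub>0\<close> has objective \<open>s 0\<close>, and the tent
function of \<open>b\<^sub>0\<close> is a member of the class with mean value \<open>s 0\<close>. Folding shows that neither the
second program nor the class admits a larger value.\<close>

theorem theorem2:
  fixes p q :: nat
  assumes "p > 0" and "coprime p q" and "2 * p \<le> q"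
  shows "(\<exists>s. lp1_optimal p q s) \<and> (\<exists>b. lp2_optimal p q b) \<and>
         A (real p / real q) = S1 p q \<and> S1 p q = S2 p q \<and>
         (\<forall>b. lp2_optimal p q b \<longrightarrow>
            phi p q b \<in> K (real p / real q) \<and>
            integral {-1/2..1/2} (phi p q b) = A (real p / real q))"
proof -
  have q: "q \<ge> 2" using assms by auto
  note phi_K = phi_in_K[OF assms(1) q assms(3)]
    and phi_exp = phi_cosine_expansion[OF assms(1) q assms(3)]
    and fold = fold_coefficients_lp1_feasible[OF assms(1,3)]
    and dual = lp1_to_lp2[OF assms(1,3)]
  have weak: "\<exists>s. lp1_feasible p q s \<and> lp2_objective p q c \<le> s 0" if "lp2_feasible p q c" for c
    using fold[OF phi_K phi_exp] that by (metis phi_coeff_0)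
  have "lp2_feasible p q (\<lambda>_. 0)" by (simp add: lp2_feasible_def)
  then obtain s where s: "lp1_optimal p q s"
    using weak lp1_optimal_exists[of q p] q by fastforce
  obtain b\<^sub>0 where b\<^sub>0: "lp2_feasible p q b\<^sub>0" "lp2_objective p q b\<^sub>0 = s 0"
    using dual s by (auto simp: lp1_optimal_def)
  have b\<^sub>0_opt: "lp2_optimal p q b\<^sub>0"
    unfolding lp2_optimal_def using b\<^sub>0 weak s by (fastforce simp: lp1_optimal_def)
  have A: "A (real p / real q) = s 0"
    unfolding A_def
  proof (rule cSup_eq_maximum)
    show "s 0 \<in> {a 0 |a f. f \<in> K (real p / real q) \<and> cosine_expansion a f}"
      unfolding mem_Collect_eq
      using phi_K[OF b\<^sub>0(1)] phi_exp[OF b\<^sub>0(1)] phi_coeff_0[of p q b\<^sub>0] b\<^sub>0(2) by metis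
    fix v assume "v \<in> {a 0 |a f. f \<in> K (real p / real q) \<and> cosine_expansion a f}"
    then show "v \<le> s 0" using fold s by (fastforce simp: lp1_optimal_def)
  qed
  have "integral {-1/2..1/2} (phi p q b) = A (real p / real q)" if "lp2_optimal p q b" for b
  proof -
    have "lp2_objective p q b = s 0"
      using S2_eq[OF that] S2_eq[OF b\<^sub>0_opt] b\<^sub>0(2) by simp
    moreover have "(phi p q b has_integral phi_coeff p q b 0) {-1/2..1/2}"
      using that by (intro cosine_expansion_mean phi_exp) (simp add: lp2_optimal_def)
    ultimately show ?thesis
      unfolding A phi_coeff_0 by (metis integral_unique)
  qed
  then show ?thesis
    using s b\<^sub>0_opt A S1_eq[OF s] S2_eq[OF b\<^sub>0_opt] b\<^sub>0(2) phi_K by (auto simp: lp2_optimal_def)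
qed

end
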